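(* There exists a monotonically shrinking temporal path $\mathcal{P}$ (that is, a monotonically shrinking temporal graph whose underlying static graph is a path) such that there is no Nash equilibrium in the two-player reverse temporal Voronoi game $\mathrm{rVor}(\mathcal{P},2)$.
   Context: A temporal graph $\mathcal{G}=(V,(E_t)_{t=1}^\infty)$ consists of a finite nonempty vertex set $V$ and an infinite sequence of edge sets $E_t\subseteq\binom{V}{2}$; it is assumed that the sequence is eventually constant (finite lifetime), i.e. there is $\tau$ with $E_t=E_\tau$ for all $t\ge\tau$. The underlying static graph is $(V,\bigcup_{t\ge1}E_t)$. A temporal path is a temporal graph whose underlying graph is a path. $\mathcal{G}$ is monotonically shrinking if $E_{t+1}\subseteq E_t$ for all $t\ge 1$. A temporal walk from $u$ to $v$ is a sequence $(\{v_0=u,v_1\},t_1),(\{v_1,v_2\},t_2),\dots,(\{v_{d-1},v_d=v\},t_d)$ with $t_i<t_{i+1}$ for all $i\in\{1,\dots,d-1\}$ (strictly increasing times) and $\{v_{i-1},v_i\}\in E_{t_i}$ for all $i\in\{1,\dots,d\}$; its arrival time is $t_d$. The temporal distance $\mathrm{td}(u,v)$ is the minimum arrival time of a temporal walk from $u$ to $v$, with $\mathrm{td}(u,u)=0$ and $\mathrm{td}(u,v)=\infty$ if there is no such walk. In the two-player reverse temporal Voronoi game $\mathrm{rVor}(\mathcal{G},2)$, each player $i\in\{1,2\}$ selects one vertex $p_i\in V$ (equal choices are allowed). Player $i$ wins the set $U_i(p_1,p_2)=\{v\in V\mid \mathrm{td}(v,p_i)<\mathrm{td}(v,p_j)\}$,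 where $j\ne i$ is the other player, and her payoff is $u_i(p_1,p_2)=|U_i(p_1,p_2)|$. A profile $(p_1,p_2)\in V^2$ is a Nash equilibrium if $u_1(p',p_2)\le u_1(p_1,p_2)$ and $u_2(p_1,p')\le u_2(p_1,p_2)$ for all $p'\in V$. *)

theory Defs
  imports Main "HOL-Library.Extended_Nat"
begin

text \<open>A temporal graph is given by its vertex set \<open>V\<close> and its sequence of edge sets \<open>E\<close>.
  Time starts at \<open>1\<close>; the value \<open>E 0\<close> is never used.\<close>

definition temporal_graph :: "'a set \<Rightarrow> (nat \<Rightarrow> 'a set set) \<Rightarrow> bool" where
  "temporal_graph V E \<longleftrightarrow>
     finite V \<and> V \<noteq> {} \<and>
     (\<forall>t\<ge>1. E t \<subseteq> {e. e \<subseteq> V \<and> card e = 2}) \<and>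
     (\<exists>\<tau>\<ge>1. \<forall>t\<ge>\<tau>. E t = E \<tau>)"

definition underlying_edges :: "(nat \<Rightarrow> 'a set set) \<Rightarrow> 'a set set" where
  "underlying_edges E = (\<Union>t\<in>{1..}. E t)"

definition path_graph :: "'a set \<Rightarrow> 'a set set \<Rightarrow> bool" where
  "path_graph V F \<longleftrightarrow>
     (\<exists>vs. vs \<noteq> [] \<and> distinct vs \<and> set vs = V \<and>
        F = {{vs ! i, vs ! Suc i} |i. Suc i < length vs})"

definition temporal_path :: "'a set \<Rightarrow> (nat \<Rightarrow> 'a set set) \<Rightarrow> bool" where
  "temporal_path V E \<longleftrightarrow> temporal_graph V E \<and> path_graph V (underlying_edges E)"

definition monotonically_shrinking :: "(nat \<Rightarrow> 'a set set) \<Rightarrow> bool" where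
  "monotonically_shrinking E \<longleftrightarrow> (\<forall>t\<ge>1. E (t + 1) \<subseteq> E t)"

text \<open>Walks consist of at least one time-edge; the case of a vertex reaching itself by not
  moving is treated separately in the definition of the temporal distance.\<close>

definition temporal_walk ::
  "(nat \<Rightarrow> 'a set set) \<Rightarrow> 'a \<Rightarrow> ('a set \<times> nat) list \<Rightarrow> 'a \<Rightarrow> bool" where
  "temporal_walk E u w v \<longleftrightarrow>
     w \<noteq> [] \<and> sorted_wrt (<) (map snd w) \<and>
     (\<exists>vs. length vs = Suc (length w) \<and> hd vs = u \<and> last vs = v \<and>
        (\<forall>i<length w. fst (w ! i) = {vs ! i, vs ! Suc i} \<and>
           1 \<le> snd (w ! i) \<and> fst (w ! i) \<in> E (snd (w ! i))))"

definition arrival_time :: "('a set \<times> nat) list \<Rightarrow> nat" where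
  "arrival_time w = snd (last w)"

text \<open>On \<^typ>\<open>enat\<close> the infimum of a nonempty set is its minimum, and the infimum
  of the empty set is \<open>\<infinity>\<close>.\<close>

definition td :: "(nat \<Rightarrow> 'a set set) \<Rightarrow> 'a \<Rightarrow> 'a \<Rightarrow> enat" where
  "td E u v = (if u = v then 0
     else Inf {enat (arrival_time w) |w. temporal_walk E u w v})"

text \<open>\<open>rvor_cell V E p q\<close> is the set won by the player at \<open>p\<close> against the player at \<open>q\<close>.
  Distances are measured towards the players' vertices, which makes the game the reverse one.\<close>

definition rvor_cell :: "'a set \<Rightarrow> (nat \<Rightarrow> 'a set set) \<Rightarrow> 'a \<Rightarrow> 'a \<Rightarrow> 'a set" where
  "rvor_cell V E p q = {v \<in> V. td E v p < td E v q}"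

definition payoff1 :: "'a set \<Rightarrow> (nat \<Rightarrow> 'a set set) \<Rightarrow> 'a \<Rightarrow> 'a \<Rightarrow> nat" where
  "payoff1 V E p\<^sub>1 p\<^sub>2 = card (rvor_cell V E p\<^sub>1 p\<^sub>2)"

definition payoff2 :: "'a set \<Rightarrow> (nat \<Rightarrow> 'a set set) \<Rightarrow> 'a \<Rightarrow> 'a \<Rightarrow> nat" where
  "payoff2 V E p\<^sub>1 p\<^sub>2 = card (rvor_cell V E p\<^sub>2 p\<^sub>1)"

definition rvor_nash_equilibrium ::
  "'a set \<Rightarrow> (nat \<Rightarrow> 'a set set) \<Rightarrow> 'a \<Rightarrow> 'a \<Rightarrow> bool" where
  "rvor_nash_equilibrium V E p\<^sub>1 p\<^sub>2 \<longleftrightarrow>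
     p\<^sub>1 \<in> V \<and> p\<^sub>2 \<in> V \<and>
     (\<forall>p'\<in>V. payoff1 V E p' p\<^sub>2 \<le> payoff1 V E p\<^sub>1 p\<^sub>2) \<and>
     (\<forall>p'\<in>V. payoff2 V E p\<^sub>1 p' \<le> payoff2 V E p\<^sub>1 p\<^sub>2)"

end

theory Submission
  imports Defs
begin

text \<open>On a monotonically shrinking path waiting never helps, so \<open>td v p\<close> is the number of edges
  between \<open>v\<close> and \<open>p\<close> if the \<open>k\<close>-th of these edges, counted from \<open>v\<close>, survives until time \<open>k\<close>
  for every \<open>k\<close>, and \<open>\<infinity>\<close> otherwise. A small path can therefore be specified by one lifetime
  per edge. For nine vertices and lifetimes 1, 2, 1, 5, 4, 3, 2, 1 the best responses to the inner
  vertices form the cycle \<open>2 \<rightarrow> 3 \<rightarrow> 4 \<rightarrow> 5 \<rightarrow> 2\<close>, and no two vertices are best responses to each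
  other.\<close>

section \<open>Temporal distances by direct walks and by potentials\<close>

lemma temporal_walk_single:
  assumes "{u, v} \<in> E t" and "1 \<le> t"
  shows "temporal_walk E u [({u, v}, t)] v"
  unfolding temporal_walk_def
  using assms by (auto intro!: exI[of _ "[u, v]"])

lemma temporal_walk_snoc:
  assumes "temporal_walk E u w v'" and "arrival_time w < t" and "{v', v} \<in> E t"
  shows "temporal_walk E u (w @ [({v', v}, t)]) v"
proof -
  from assms(1) obtain vs where w: "w \<noteq> []" "sorted_wrt (<) (map snd w)"
    and vs: "length vs = Suc (length w)" "hd vs = u" "last vs = v'"
    and steps: "\<forall>i<length w. fst (w ! i) = {vs ! i, vs ! Suc i} \<and>
           1 \<le> snd (w ! i) \<and> fst (w ! i) \<in> E (snd (w ! i))"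
    unfolding temporal_walk_def by blast
  \<comment> \<open>Times increase strictly, so the last one is the largest; a time beyond
    \<open>arrival_time w\<close> therefore exceeds every time of \<open>w\<close>, as
    \<open>sorted_wrt\<close> demands of the extended list.\<close>
  have le: "s \<le> arrival_time w" if "s \<in> snd ` set w" for s
  proof -
    have "sorted (map snd w)"
      using w(2) by (rule sorted_wrt_mono_rel[rotated]) simp
    moreover have "arrival_time w = last (map snd w)"
      using w(1) by (simp add: arrival_time_def last_map)
    moreover obtain i where "i < length w" "s = map snd w ! i"
      using \<open>s \<in> snd ` set w\<close> by (auto simp: in_set_conv_nth)
    ultimately show ?thesis
      using w(1) sorted_nth_mono[of "map snd w" i "length w - 1"]
      by (simp add: last_conv_nth)
  qed
  have "vs ! length w = v'"
    using vs by (metis Zero_not_Suc diff_Suc_1 last_conv_nth list.size(3))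
  have new_steps: "fst ((w @ [({v', v}, t)]) ! i) = {(vs @ [v]) ! i, (vs @ [v]) ! Suc i} \<and>
      1 \<le> snd ((w @ [({v', v}, t)]) ! i) \<and>
      fst ((w @ [({v', v}, t)]) ! i) \<in> E (snd ((w @ [({v', v}, t)]) ! i))"
    if "i < length (w @ [({v', v}, t)])" for i
  proof (cases "i < length w")
    case True
    with steps[rule_format, OF this] vs(1) show ?thesis by (auto simp: nth_append)
  next
    case False
    with that have "i = length w" by simp
    with \<open>vs ! length w = v'\<close> vs(1) assms(2,3) show ?thesis by (simp add: nth_append)
  qed
  moreover have "sorted_wrt (<) (map snd (w @ [({v', v}, t)]))"
    using w(2) le assms(2) by (force simp: sorted_wrt_append)
  moreover have "hd (vs @ [v]) = u"
    using vs by (metis Zero_not_Suc hd_append2 list.size(3))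
  moreover have "length (vs @ [v]) = Suc (length (w @ [({v', v}, t)]))"
    using vs(1) by simp
  moreover have "w @ [({v', v}, t)] \<noteq> []" "last (vs @ [v]) = v"
    by simp_all
  ultimately show ?thesis
    unfolding temporal_walk_def using new_steps by blast
qed

text \<open>This supplies the upper bound on distances: moving at every time step from time 1 on
  makes the arrival time equal to the number of edges.\<close>

lemma direct_temporal_walk:
  assumes "\<And>j. j < Suc d \<Longrightarrow> {x j, x (Suc j)} \<in> E (Suc j)"
  shows "\<exists>w. temporal_walk E (x 0) w (x (Suc d)) \<and> arrival_time w = Suc d"
  using assms
proof (induction d)
  case 0
  then show ?case
    using temporal_walk_single[of "x 0" "x 1" E 1]
    by (intro exI[of _ "[({x 0, x 1}, 1)]"]) (simp add: arrival_time_def)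
next
  case (Suc d)
  then obtain w where "temporal_walk E (x 0) w (x (Suc d))" "arrival_time w = Suc d"
    by (meson less_Suc_eq)
  with Suc.prems[of "Suc d"] show ?case
    by (intro exI[of _ "w @ [({x (Suc d), x (Suc (Suc d))}, Suc (Suc d))]"])
      (auto intro!: temporal_walk_snoc simp: arrival_time_def)
qed

text \<open>Each step raises \<open>f\<close> by at most 1 and the time by at least 1, so
  \<open>f\<close> never exceeds the current time. As \<open>f\<close> cannot skip a value on its
  way up, the walk crosses from each level \<open>j\<close> to \<open>Suc j\<close>, and does so no
  earlier than time \<open>Suc j\<close>.\<close>

lemma temporal_walk_potential:
  fixes f :: "'a \<Rightarrow> nat"
  assumes "temporal_walk E u w v"
    and f0: "f u = 0"
    and lip: "\<And>t a b. {a, b} \<in> E t \<Longrightarrow> f b \<le> Suc (f a)"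
  shows "f v \<le> arrival_time w"
    and "\<forall>j<f v. \<exists>s\<ge>Suc j. \<exists>a b. f a = j \<and> f b = Suc j \<and> {a, b} \<in> E s"
proof -
  from assms(1) obtain vs where w: "w \<noteq> []" "sorted_wrt (<) (map snd w)"
    and vs: "length vs = Suc (length w)" "hd vs = u" "last vs = v"
    and steps: "\<And>i. i < length w \<Longrightarrow> fst (w ! i) = {vs ! i, vs ! Suc i} \<and>
           1 \<le> snd (w ! i) \<and> fst (w ! i) \<in> E (snd (w ! i))"
    unfolding temporal_walk_def by blast
  have vs0: "vs ! 0 = u"
    using vs by (metis Zero_not_Suc hd_conv_nth list.size(3))
  have step: "f (vs ! i) \<le> i \<and> f (vs ! Suc i) \<le> snd (w ! i) \<and>
     (\<forall>j<f (vs ! Suc i). \<exists>s\<ge>Suc j. \<exists>a b. f a = j \<and> f b = Suc j \<and> {a, b} \<in> E s)"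
    if "i < length w" for i
    using that
  proof (induction i)
    case 0
    then have "{vs ! 0, vs ! 1} \<in> E (snd (w ! 0))" "1 \<le> snd (w ! 0)"
      using steps[of 0] by auto
    with lip[OF this(1)] f0 vs0 show ?case
      by (cases "f (vs ! 1)") (auto intro!: exI[of _ "snd (w ! 0)"])
  next
    case (Suc i)
    then have IH: "f (vs ! i) \<le> i" "f (vs ! Suc i) \<le> snd (w ! i)"
      "\<forall>j<f (vs ! Suc i). \<exists>s\<ge>Suc j. \<exists>a b. f a = j \<and> f b = Suc j \<and> {a, b} \<in> E s"
      by auto
    let ?t = "snd (w ! Suc i)"
    have e: "{vs ! Suc i, vs ! Suc (Suc i)} \<in> E ?t"
      using steps[OF Suc.prems] by auto
    have e': "{vs ! i, vs ! Suc i} \<in> E (snd (w ! i))"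
      using steps[of i] Suc.prems by auto
    have "snd (w ! i) < ?t"
      using w(2) Suc.prems by (auto simp: sorted_wrt_iff_nth_less)
    then have t: "Suc (f (vs ! Suc i)) \<le> ?t"
      using IH(2) by simp
    have "\<exists>s\<ge>Suc j. \<exists>a b. f a = j \<and> f b = Suc j \<and> {a, b} \<in> E s"
      if "j < f (vs ! Suc (Suc i))" for j
    proof (cases "j < f (vs ! Suc i)")
      case False
      \<comment> \<open>Level \<open>Suc j\<close> is exceeded or met for the first time, so the
        current step itself climbs from \<open>j\<close> to \<open>Suc j\<close>; by
        \<open>t\<close> its time is late enough.\<close>
      with that lip[OF e] have "f (vs ! Suc i) = j" "f (vs ! Suc (Suc i)) = Suc j"
        by auto
      with e t show ?thesis by blast
    qed (use IH(3) in blast)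
    with IH(1) lip[OF e] lip[OF e'] t show ?case
      by auto
  qed
  have "vs ! length w = v"
    using vs by (metis Zero_not_Suc diff_Suc_1 last_conv_nth list.size(3))
  with w(1) step[of "length w - 1"]
  show "f v \<le> arrival_time w"
    and "\<forall>j<f v. \<exists>s\<ge>Suc j. \<exists>a b. f a = j \<and> f b = Suc j \<and> {a, b} \<in> E s"
    by (auto simp: arrival_time_def last_conv_nth)
qed

text \<open>The potential \<open>f\<close> bounds the distance from below, the direct walk
  \<open>x\<close> from above. Shrinking enters through \<open>cross\<close>: if level
  \<open>j\<close> can be crossed at some time from \<open>Suc j\<close> on, then the direct walk
  can cross it at time \<open>Suc j\<close>. Hence any walk at all forces the direct one to exist,
  and only \<open>Suc d\<close> and infinity remain.\<close>

lemma td_eqI: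
  fixes f :: "'a \<Rightarrow> nat"
  assumes "f u = 0" and "f v = Suc d"
    and lip: "\<And>t a b. {a, b} \<in> E t \<Longrightarrow> f b \<le> Suc (f a)"
    and "x 0 = u" and "x (Suc d) = v"
    and cross: "\<And>j s a b. j < Suc d \<Longrightarrow> Suc j \<le> s \<Longrightarrow> f a = j \<Longrightarrow> f b = Suc j \<Longrightarrow>
      {a, b} \<in> E s \<Longrightarrow> {x j, x (Suc j)} \<in> E (Suc j)"
  shows "td E u v =
    (if \<forall>j<Suc d. {x j, x (Suc j)} \<in> E (Suc j) then enat (Suc d) else \<infinity>)"
proof -
  let ?A = "{enat (arrival_time w) |w. temporal_walk E u w v}"
  have td: "td E u v = Inf ?A"
    using assms(1,2) by (auto simp: td_def)
  show ?thesis
  proof (cases "\<forall>j<Suc d. {x j, x (Suc j)} \<in> E (Suc j)")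
    case True
    then obtain w where "temporal_walk E u w v" "arrival_time w = Suc d"
      using direct_temporal_walk[of d x E] assms(4,5) by blast
    then have "enat (Suc d) \<in> ?A" by force
    moreover have "enat (Suc d) \<le> y" if "y \<in> ?A" for y
      using that temporal_walk_potential(1)[where f = f, OF _ assms(1) lip] assms(2) by fastforce
    ultimately have "Inf ?A = enat (Suc d)"
      by (intro antisym Inf_lower Inf_greatest)
    with True td show ?thesis by simp
  next
    case False
    have "\<not> temporal_walk E u w v" for w
    proof
      assume "temporal_walk E u w v"
      then have "\<forall>j<f v. \<exists>s\<ge>Suc j. \<exists>a b. f a = j \<and> f b = Suc j \<and> {a, b} \<in> E s"
        using assms(1) lip by (rule temporal_walk_potential(2))
      with assms(2) cross False show False by metis
    qed
    then have "?A = {}" by blast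
    with False td show ?thesis by (simp add: top_enat_def)
  qed
qed

section \<open>Paths given by edge lifetimes\<close>

definition lifetime_edges :: "nat list \<Rightarrow> nat \<Rightarrow> nat set set" where
  "lifetime_edges L t = {{i, Suc i} |i. i < length L \<and> t \<le> L ! i}"

lemma edge_in_lifetime_edges:
  "{i, Suc i} \<in> lifetime_edges L t \<longleftrightarrow> i < length L \<and> t \<le> L ! i"
  unfolding lifetime_edges_def by (auto simp: doubleton_eq_iff)

lemma lifetime_edges_neighbours:
  assumes "{a, b} \<in> lifetime_edges L t"
  shows "b = Suc a \<or> a = Suc b"
  using assms unfolding lifetime_edges_def by (auto simp: doubleton_eq_iff)

lemma monotonically_shrinking_lifetime_edges: "monotonically_shrinking (lifetime_edges L)"
  unfolding monotonically_shrinking_def lifetime_edges_def by fastforce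

lemma temporal_path_lifetime_edges:
  assumes "\<forall>l\<in>set L. 1 \<le> l"
  shows "temporal_path {..length L} (lifetime_edges L)"
proof -
  \<comment> \<open>The sum of all lifetimes is a crude bound on each of them; after it the edge set
    stays empty, which gives the finite lifetime.\<close>
  have "lifetime_edges L t = {}" if "Suc (sum_list L) \<le> t" for t
  proof -
    have "L ! i < t" if "i < length L" for i
      using \<open>Suc (sum_list L) \<le> t\<close> member_le_sum_list[OF nth_mem[OF that]] by simp
    then show ?thesis
      unfolding lifetime_edges_def by (auto simp: not_le)
  qed
  then have "\<exists>\<tau>\<ge>1. \<forall>t\<ge>\<tau>. lifetime_edges L t = lifetime_edges L \<tau>"
    by (intro exI[of _ "Suc (sum_list L)"]) simp
  moreover have "lifetime_edges L t \<subseteq> {e. e \<subseteq> {..length L} \<and> card e = 2}" for t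
    unfolding lifetime_edges_def by auto
  ultimately have "temporal_graph {..length L} (lifetime_edges L)"
    unfolding temporal_graph_def by auto
  have "underlying_edges (lifetime_edges L) = {{i, Suc i} |i. i < length L}"
  proof -
    have "i < length L \<Longrightarrow> 1 \<le> L ! i" for i
      using assms by simp
    then show ?thesis
      unfolding underlying_edges_def lifetime_edges_def by blast
  qed
  moreover have "{{i, Suc i} |i. i < length L} =
      {{[0..<Suc (length L)] ! i, [0..<Suc (length L)] ! Suc i} |i.
        Suc i < length [0..<Suc (length L)]}"
    by (intro Collect_cong ex_cong1) (auto simp del: upt_Suc simp: nth_upt)
  ultimately have "path_graph {..length L} (underlying_edges (lifetime_edges L))"
    unfolding path_graph_def
    by (intro exI[of _ "[0..<Suc (length L)]"])
      (simp del: upt_Suc add: atLeast0LessThan lessThan_Suc_atMost)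
  with \<open>temporal_graph _ _\<close> show ?thesis
    unfolding temporal_path_def by blast
qed

text \<open>Phrased with \<open>list_all\<close> over intervals so that it can be evaluated. The
  edge joining \<open>i\<close> and \<open>Suc i\<close> has index \<open>i\<close>, so the
  \<open>j\<close>-th edge from \<open>v\<close> has index \<open>v + j\<close> to the right but
  \<open>v - Suc j\<close> to the left.\<close>

definition reaches :: "nat list \<Rightarrow> nat \<Rightarrow> nat \<Rightarrow> bool" where
  "reaches L v p \<longleftrightarrow>
     (if v \<le> p then list_all (\<lambda>j. Suc j \<le> L ! (v + j)) [0..<p - v]
      else list_all (\<lambda>j. Suc j \<le> L ! (v - Suc j)) [0..<v - p])"

text \<open>This is the absolute difference: truncated subtraction makes one summand zero.\<close>

definition path_dist :: "nat \<Rightarrow> nat \<Rightarrow> nat" where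
  "path_dist v p = (v - p) + (p - v)"

text \<open>The truncated potential \<open>y - v\<close> is 0 on everything left of
  \<open>v\<close>, hence still changes by at most 1 along an edge, and each level has a single edge
  leading up from it.\<close>

lemma td_lifetime_edges_right:
  assumes "v + Suc d \<le> length L"
  shows "td (lifetime_edges L) v (v + Suc d) =
    (if \<forall>j<Suc d. Suc j \<le> L ! (v + j) then enat (Suc d) else \<infinity>)"
proof -
  have cross: "{v + j, v + Suc j} \<in> lifetime_edges L (Suc j)"
    if "Suc j \<le> s" "a - v = j" "b - v = Suc j" "{a, b} \<in> lifetime_edges L s" for j s a b
  proof -
    have "b = Suc a" "a = v + j"
      using that lifetime_edges_neighbours[OF that(4)] by auto
    with that(1,4) show ?thesis
      by (simp add: edge_in_lifetime_edges)
  qed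
  have lip: "b - v \<le> Suc (a - v)" if "{a, b} \<in> lifetime_edges L t" for t a b
    using lifetime_edges_neighbours[OF that] by auto
  have "td (lifetime_edges L) v (v + Suc d) =
    (if \<forall>j<Suc d. {v + j, v + Suc j} \<in> lifetime_edges L (Suc j) then enat (Suc d) else \<infinity>)"
    by (rule td_eqI[where f = "\<lambda>y. y - v" and x = "\<lambda>j. v + j"])
      (simp_all only: lip cross add_diff_cancel_left' diff_self_eq_0 add_0_right)
  then show ?thesis
    using assms by (simp add: edge_in_lifetime_edges)
qed

lemma td_lifetime_edges_left:
  assumes "p + Suc d \<le> length L"
  shows "td (lifetime_edges L) (p + Suc d) p =
    (if \<forall>j<Suc d. Suc j \<le> L ! (p + d - j) then enat (Suc d) else \<infinity>)"
proof -
  let ?v = "p + Suc d"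
  have cross: "{?v - j, ?v - Suc j} \<in> lifetime_edges L (Suc j)"
    if "Suc j \<le> s" "?v - a = j" "?v - b = Suc j" "{a, b} \<in> lifetime_edges L s" for j s a b
  proof -
    have "a = Suc b" "?v - j = a" "?v - Suc j = b"
      using that lifetime_edges_neighbours[OF that(4)] by auto
    with that(1,4) show ?thesis
      by (simp add: edge_in_lifetime_edges insert_commute[of "Suc b"])
  qed
  have lip: "?v - b \<le> Suc (?v - a)" if "{a, b} \<in> lifetime_edges L t" for t a b
    using lifetime_edges_neighbours[OF that] by auto
  have "td (lifetime_edges L) ?v p =
    (if \<forall>j<Suc d. {?v - j, ?v - Suc j} \<in> lifetime_edges L (Suc j) then enat (Suc d) else \<infinity>)"
    by (rule td_eqI[where f = "\<lambda>y. ?v - y" and x = "\<lambda>j. ?v - j"])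
      (simp_all only: lip cross add_diff_cancel_left' add_diff_cancel_right' diff_self_eq_0 diff_zero)
  moreover have "{?v - j, ?v - Suc j} \<in> lifetime_edges L (Suc j) \<longleftrightarrow> Suc j \<le> L ! (p + d - j)"
    if "j < Suc d" for j
  proof -
    \<comment> \<open>The edge is indexed by its smaller endpoint, here the one reached after the
      \<open>j\<close>-th step to the left.\<close>
    have "?v - j = Suc (p + d - j)" "?v - Suc j = p + d - j" "p + d - j < length L"
      using that assms by auto
    then show ?thesis
      by (simp add: edge_in_lifetime_edges insert_commute[of "Suc (p + d - j)"])
  qed
  ultimately show ?thesis
    by simp
qed

lemma td_lifetime_edges:
  assumes "v \<le> length L" and "p \<le> length L"
  shows "td (lifetime_edges L) v p = (if reaches L v p then enat (path_dist v p) else \<infinity>)"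
proof (cases v p rule: linorder_cases)
  case equal
  then show ?thesis
    by (simp add: td_def reaches_def path_dist_def zero_enat_def)
next
  case less
  then obtain d where "p = v + Suc d"
    using less_imp_Suc_add by auto
  with td_lifetime_edges_right[of v d L] assms show ?thesis
    by (simp del: upt_Suc add: reaches_def path_dist_def list_all_iff)
next
  case greater
  then obtain d where "v = p + Suc d"
    using less_imp_Suc_add by auto
  with td_lifetime_edges_left[of p d L] assms show ?thesis
    by (simp del: upt_Suc add: reaches_def path_dist_def list_all_iff)
qed

text \<open>Strict comparison of two distances in \<open>enat\<close>: failing to reach
  \<open>q\<close> counts as infinitely far, and a vertex reaching neither is won by nobody.\<close>

definition nearer :: "nat list \<Rightarrow> nat \<Rightarrow> nat \<Rightarrow> nat \<Rightarrow> bool" where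
  "nearer L p q v \<longleftrightarrow> reaches L v p \<and> (reaches L v q \<longrightarrow> path_dist v p < path_dist v q)"

definition won :: "nat list \<Rightarrow> nat \<Rightarrow> nat \<Rightarrow> nat" where
  "won L p q = length (filter (nearer L p q) [0..<Suc (length L)])"

lemma card_rvor_cell_lifetime_edges:
  assumes "p \<le> length L" and "q \<le> length L"
  shows "card (rvor_cell {..length L} (lifetime_edges L) p q) = won L p q"
proof -
  have "rvor_cell {..length L} (lifetime_edges L) p q =
      set (filter (nearer L p q) [0..<Suc (length L)])"
    using assms unfolding rvor_cell_def nearer_def
    by (auto simp del: upt_Suc simp: td_lifetime_edges less_Suc_eq_le split: if_splits)
  then show ?thesis
    unfolding won_def by (metis distinct_card distinct_filter distinct_upt)
qed

section \<open>A path without equilibrium\<close>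

definition cyclic_lifetimes :: "nat list" where
  "cyclic_lifetimes = [1, 2, 1, 5, 4, 3, 2, 1]"

text \<open>Entry \<open>q\<close> serves as a list containing every best response to
  \<open>q\<close>; its head supplies the payoff to beat.\<close>

definition best_responses :: "nat list list" where
  "best_responses =
     [[3, 4, 5], [3, 4], [3], [4], [5], [2], [1, 2, 5], [1, 2, 4, 5, 6], [3, 4, 5]]"

text \<open>A finite evaluation: every unlisted vertex earns strictly less against \<open>q\<close>
  than the head of the list, so it cannot be a best response.\<close>

lemma won_best_response:
  "list_all (\<lambda>q. let m = won cyclic_lifetimes (hd (best_responses ! q)) q in
     list_all (\<lambda>p. p \<in> set (best_responses ! q) \<or> won cyclic_lifetimes p q < m) [0..<9]) [0..<9]"
  by code_simp

text \<open>The cycle on 2, 3, 4, 5 is never left, and outside it the only responses are 6 to 1, 7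
  to 1 and 7 to 6, none of them reciprocated. The case \<open>p = q\<close> excludes equal choices
  as well.\<close>

lemma best_responses_not_mutual:
  "list_all (\<lambda>q. list_all (\<lambda>p. q \<notin> set (best_responses ! p)) (best_responses ! q)) [0..<9]"
  by (simp add: best_responses_def upt_rec)

lemma best_response_is_vertex:
  "list_all (\<lambda>q. hd (best_responses ! q) < 9) [0..<9]"
  by (simp add: best_responses_def upt_rec)

theorem theorem6:
  shows "\<exists>(V :: nat set) (E :: nat \<Rightarrow> nat set set).
    temporal_path V E \<and> monotonically_shrinking E \<and>
    \<not> (\<exists>p\<^sub>1 p\<^sub>2. rvor_nash_equilibrium V E p\<^sub>1 p\<^sub>2)"
proof (intro exI conjI)
  let ?L = cyclic_lifetimes
  let ?V = "{..length ?L}" and ?E = "lifetime_edges ?L"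
  have len: "length ?L = 8"
    by (simp add: cyclic_lifetimes_def)
  show "temporal_path ?V ?E"
    by (rule temporal_path_lifetime_edges) (simp add: cyclic_lifetimes_def)
  show "monotonically_shrinking ?E"
    by (rule monotonically_shrinking_lifetime_edges)
  have best: "p \<in> set (best_responses ! q)"
    if "p \<in> ?V" "q \<in> ?V" "\<forall>p'\<in>?V. won ?L p' q \<le> won ?L p q" for p q
  proof -
    have "p \<in> set [0..<9]" "q \<in> set [0..<9]"
      using that len by auto
    \<comment> \<open>The head must be a vertex of the path to count as a legal deviation against
      \<open>q\<close>.\<close>
    then have "hd (best_responses ! q) \<in> ?V"
      and "p \<in> set (best_responses ! q) \<or> won ?L p q < won ?L (hd (best_responses ! q)) q"
      using won_best_response best_response_is_vertex len
      unfolding list_all_iff Let_def by fastforce+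
    with that(3) show ?thesis by (meson not_le)
  qed
  show "\<not> (\<exists>p\<^sub>1 p\<^sub>2. rvor_nash_equilibrium ?V ?E p\<^sub>1 p\<^sub>2)"
  proof clarify
    fix p q
    assume "rvor_nash_equilibrium ?V ?E p q"
    \<comment> \<open>Both payoffs are \<open>won\<close> with the player's own vertex first, so an
      equilibrium consists of two mutual best responses.\<close>
    then have V: "p \<in> ?V" "q \<in> ?V"
      and "\<forall>p'\<in>?V. won ?L p' q \<le> won ?L p q" "\<forall>p'\<in>?V. won ?L p' p \<le> won ?L q p"
      unfolding rvor_nash_equilibrium_def payoff1_def payoff2_def
      by (auto simp: card_rvor_cell_lifetime_edges)
    then have "p \<in> set (best_responses ! q)" "q \<in> set (best_responses ! p)"
      using best by blast+
    moreover have "q \<in> set [0..<9]"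
      using V len by auto
    ultimately show False
      using best_responses_not_mutual unfolding list_all_iff by blast
  qed
qed

end
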